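(* Let $M$, $C$, $W$, $P$, $Q$ and the sequences $\mathbf{x}^{\langle k\rangle}$, $\mathbf{y}^{\langle k\rangle}$ be as in the context. Then the sequences $(\mathbf{x}^{\langle k\rangle})_{k\ge 0}$ and $(\mathbf{y}^{\langle k\rangle})_{k\ge 0}$ converge, as $k\to\infty$, to limits $\mathbf{x}^\star\in\mathbb{R}^m$ and $\mathbf{y}^\star\in\mathbb{R}^n$ respectively. Moreover, $\mathbf{x}^\star$ is a principal eigenvector of $P = W(I+C^T)M^T$, and $\mathbf{y}^\star$ is a principal eigenvector of $Q=(I+C^T)M^TW$. Further, both $\mathbf{x}^\star$ and $\mathbf{y}^\star$ have all components non-negative and are non-zero (their components sum to $1$).
   Context: There are $m$ authors $a_1,\dots,a_m$ and $n$ papers $p_1,\dots,p_n$. The publication matrix $M=(m_{ij})$ is the $m\times n$ $0$-$1$ matrix with $m_{ij}=1$ iff author $a_i$ wrote paper $p_j$; every paper has at least one author, i.e. $\sum_{i=1}^m m_{ij}\ge 1$ for every $j$. The citation matrix $C=(c_{jk})$ is the $n\times n$ $0$-$1$ matrix with $c_{jk}=1$ iff paper $p_j$ cites paper $p_k$; the directed citation graph (edge $p_j\to p_k$ iff $c_{jk}=1$) has no directed cycles. The weight matrix $W=(w_{ij})$ is the $m\times n$ matrix with $w_{ij}=m_{ij}/\sum_{l=1}^m m_{lj}$. $I$ denotes the $n\times n$ identity matrix. Set $P=W(I+C^T)M^T$ (an $m\times m$ non-negative matrix) and $Q=(I+C^T)M^TW$ (an $n\times n$ non-negative matrix). Let $\mathbf{x}^{\langle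 0\rangle}=\mathbf{1}\in\mathbb{R}^m$ and $\mathbf{y}^{\langle 0\rangle}=\mathbf{1}\in\mathbb{R}^n$ be all-ones vectors, and for $k\ge 0$ let the (normalized) author and paper score vectors be $\mathbf{x}^{\langle k\rangle}=P^k\mathbf{x}^{\langle 0\rangle}/\|P^k\mathbf{x}^{\langle 0\rangle}\|_1$ and $\mathbf{y}^{\langle k\rangle}=Q^k\mathbf{y}^{\langle 0\rangle}/\|Q^k\mathbf{y}^{\langle 0\rangle}\|_1$, so that each vector has non-negative entries summing to $1$ (this corresponds to iterating the update rules $\mathbf{x}\leftarrow W\mathbf{y}$, $\mathbf{y}\leftarrow M^T\mathbf{x}$, $\mathbf{y}\leftarrow (I+C^T)\mathbf{y}$ and normalizing each iterate to sum $1$). A principal eigenvector of a square non-negative matrix $A$ is an eigenvector of $A$ associated with an eigenvalue of maximal modulus (the spectral radius of $A$). *)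

theory Defs
  imports "HOL-Analysis.Analysis"
begin

text \<open>Complexification of a real matrix.\<close>
definition cmat :: "real^'n^'n \<Rightarrow> complex^'n^'n" where
  "cmat A = (\<chi> i j. complex_of_real (A $ i $ j))"

text \<open>Eigenvalues (complex) of a real square matrix.\<close>
definition eigenvalues :: "real^'n^'n \<Rightarrow> complex set" where
  "eigenvalues A = {c. \<exists>v::complex^'n. v \<noteq> 0 \<and> cmat A *v v = c *s v}"

definition spectral_radius :: "real^'n^'n \<Rightarrow> real" where
  "spectral_radius A = Max (cmod ` eigenvalues A)"

text \<open>Principal eigenvector: eigenvector for an eigenvalue of maximal modulus.\<close>
definition principal_eigenvector :: "real^'n^'n \<Rightarrow> real^'n \<Rightarrow> bool" where
  "principal_eigenvector A x \<longleftrightarrow>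
     x \<noteq> 0 \<and> (\<exists>c::real. A *v x = c *s x \<and> \<bar>c\<bar> = spectral_radius A)"

definition norm1 :: "real^'n \<Rightarrow> real" where
  "norm1 v = (\<Sum>i\<in>UNIV. \<bar>v $ i\<bar>)"

text \<open>k-th matrix power applied to the all-ones vector, normalised in the 1-norm.\<close>
definition power_iter :: "real^'n^'n \<Rightarrow> nat \<Rightarrow> real^'n" where
  "power_iter A k = (let v = (((*v) A) ^^ k) (\<chi> i. 1) in (1 / norm1 v) *\<^sub>R v)"

text \<open>Weight matrix W from the publication matrix M (authors 'a, papers 'p).\<close>
definition weight_matrix :: "real^'p^'a \<Rightarrow> real^'p^'a" where
  "weight_matrix M = (\<chi> i j. M $ i $ j / (\<Sum>l\<in>UNIV. M $ l $ j))"

end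

theory Submission
  imports
    Defs
    "HOL-Computational_Algebra.Field_as_Ring"
    "HOL-Computational_Algebra.Polynomial_Factorial"
    "HOL-Computational_Algebra.Fundamental_Theorem_Algebra"
begin

text \<open>
  Entrywise \<open>Q \<ge> I\<close>. Let \<open>u\<close> be a positive vector, \<open>p\<close> the minimal polynomial of \<open>u\<close> under \<open>Q\<close>,
  and \<open>R\<close> the largest modulus of a root of \<open>p\<close>, so that \<open>Q\<^sup>k u = O(s\<^sup>k)\<close> for every \<open>s > R\<close>.
  If \<open>z\<close> is an eigenvector of \<open>Q\<close> with eigenvalue \<open>c\<close>, then \<open>(1 + \<bar>c - 1\<bar>) \<bar>z\<bar> \<le> Q \<bar>z\<bar>\<close>, and comparing
  \<open>\<bar>z\<bar>\<close> with a multiple of \<open>u\<close> yields \<open>1 + \<bar>c - 1\<bar> \<le> R\<close>. Hence \<open>R\<close> is the spectral radius, and the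
  only root of \<open>p\<close> of modulus \<open>R\<close> is \<open>R\<close> itself. Splitting off the power of \<open>x - R\<close> in \<open>p\<close> by Bezout
  writes \<open>u\<close> as a generalised eigenvector for \<open>R\<close> plus a part of smaller exponential growth, so
  \<open>Q\<^sup>k u / (R\<^sup>k k\<^sup>d)\<close> converges to a nonzero eigenvector for some \<open>d\<close>.

  With \<open>B = (I + C\<^sup>T) M\<^sup>T\<close> one has \<open>P = W B\<close> and \<open>Q = B W\<close>. These share their nonzero eigenvalues,
  and \<open>P\<^sup>k\<^sup>+\<^sup>1 1 = W Q\<^sup>k (B 1)\<close> with \<open>B 1\<close> positive, which settles \<open>P\<close>.
\<close>

section \<open>Polynomials in a matrix acting on a vector\<close>

text \<open>This is \<open>p(A) v\<close> in Horner form. Acting on a vector, without forming the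
  matrix \<open>p(A)\<close>, lets the module laws be proved by induction over the
  coefficients.\<close>

definition poly_act :: "'a::field^'n^'n \<Rightarrow> 'a poly \<Rightarrow> 'a^'n \<Rightarrow> 'a^'n" where
  "poly_act A p v = fold_coeffs (\<lambda>c w. c *s v + A *v w) p 0"

lemma poly_act_0 [simp]: "poly_act A 0 v = 0"
  by (simp add: poly_act_def)

lemma poly_act_pCons [simp]: "poly_act A (pCons c p) v = c *s v + A *v poly_act A p v"
  by (cases "p = 0 \<and> c = 0") (auto simp: poly_act_def)

lemma poly_act_1 [simp]: "poly_act A 1 v = v"
  by (simp add: one_pCons)

lemma poly_act_zero_right [simp]: "poly_act A p 0 = 0"
  by (induction p) auto

lemma poly_act_add: "poly_act A (p + q) v = poly_act A p v + poly_act A q v"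
  by (induction p q rule: poly_induct2)
     (simp_all add: matrix_vector_right_distrib vector_sadd_rdistrib algebra_simps)

lemma poly_act_smult: "poly_act A (smult c p) v = c *s poly_act A p v"
  by (induction p)
     (simp_all add: vector_scalar_commute vector_smult_assoc vector_add_ldistrib)

lemma poly_act_mult: "poly_act A (p * q) v = poly_act A p (poly_act A q v)"
  by (induction p) (simp_all add: poly_act_add poly_act_smult)

lemma poly_act_sum: "poly_act A (sum f I) v = (\<Sum>i\<in>I. poly_act A (f i) v)"
  by (induction I rule: infinite_finite_induct) (simp_all add: poly_act_add)

lemma poly_act_monom: "poly_act A (monom c i) v = c *s (((*v) A) ^^ i) v"
  by (induction i) (simp_all add: monom_0 monom_Suc vector_scalar_commute)

lemma poly_act_add_right: "poly_act A p (v + w) = poly_act A p v + poly_act A p w"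
  by (induction p)
     (simp_all add: matrix_vector_right_distrib vector_add_ldistrib algebra_simps)

lemma poly_act_scale_right: "poly_act A p (c *s v) = c *s poly_act A p v"
  by (induction p)
     (simp_all add: vector_scalar_commute vector_smult_assoc vector_add_ldistrib mult.commute)

lemma poly_act_eigenvector:
  assumes "A *v z = c *s z"
  shows "poly_act A p z = poly p c *s z"
  by (induction p)
     (simp_all add: assms vector_scalar_commute vector_smult_assoc vector_sadd_rdistrib mult.commute)

text \<open>In dimension \<open>N\<close> the \<open>N + 1\<close> vectors
  \<open>v, A v, ..., A ^ N v\<close> are linearly dependent, and the coefficients of a relation
  between them are those of \<open>p\<close>.\<close>

lemma annihilating_poly_exists:
  fixes A :: "'a::field^'n^'n"
  obtains p where "p \<noteq> 0" "poly_act A p v = 0"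
proof -
  define f where "f i = (((*v) A) ^^ i) v" for i
  define N where "N = CARD('n)"
  \<comment> \<open>Linear dependence is a property of sets and does not see repetitions, so two
    equal iterates are handled apart, with \<open>x ^ i - x ^ j\<close>.\<close>
  show ?thesis
  proof (cases "inj_on f {..N}")
    case False
    then obtain i j where ij: "i \<noteq> j" "f i = f j"
      by (auto simp: inj_on_def)
    have eq: "monom 1 i + monom (-1) j = monom 1 i - monom (1::'a) j"
      by (simp flip: minus_monom)
    have "monom 1 i - monom (1::'a) j \<noteq> 0"
      using ij by (simp add: monom_eq_iff')
    moreover have "poly_act A (monom 1 i + monom (-1) j) v = 0"
      using ij unfolding poly_act_add poly_act_monom f_def by simp
    ultimately show ?thesis using that eq by metis
  next
    case True
    have "vec.dim (f ` {..N}) \<le> N"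
      using vec.dim_subset_UNIV[of "f ` {..N}"] by (simp add: N_def vec.dimension_def card_cart_basis)
    moreover have "card (f ` {..N}) = Suc N"
      using card_image[OF True] by simp
    ultimately have "vec.dependent (f ` {..N})"
      by (intro vec.dependent_biggerset_general) simp
    then obtain c w where c: "w \<in> f ` {..N}" "c w \<noteq> 0" "(\<Sum>x\<in>f ` {..N}. c x *s x) = 0"
      by (auto simp: vec.dependent_finite)
    then obtain i where i: "i \<le> N" "c (f i) \<noteq> 0" by auto
    define p where "p = (\<Sum>i\<le>N. monom (c (f i)) i)"
    have "coeff p i = c (f i)"
      using i by (simp add: p_def coeff_sum)
    then have "p \<noteq> 0" using i by auto
    moreover have "poly_act A p v = (\<Sum>i\<le>N. c (f i) *s f i)"
      by (simp add: p_def poly_act_sum poly_act_monom f_def)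
    then have "poly_act A p v = 0"
      using c(3) by (simp add: sum.reindex[OF True])
    ultimately show ?thesis using that by blast
  qed
qed

lemma minimal_annihilating_poly_exists:
  fixes A :: "'a::field^'n^'n"
  obtains p where "p \<noteq> 0" "poly_act A p v = 0"
    "\<And>q. q \<noteq> 0 \<Longrightarrow> poly_act A q v = 0 \<Longrightarrow> degree p \<le> degree q"
proof -
  define P where "P p \<longleftrightarrow> p \<noteq> 0 \<and> poly_act A p v = 0" for p
  obtain p0 where p0: "P p0" using annihilating_poly_exists[of A v] P_def by metis
  show ?thesis
  proof (rule that)
    show "arg_min degree P \<noteq> 0" "poly_act A (arg_min degree P) v = 0"
      using arg_min_natI[of P p0 degree, OF p0] by (simp_all add: P_def)
    show "degree (arg_min degree P) \<le> degree q" if "q \<noteq> 0" "poly_act A q v = 0" for q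
      using arg_min_nat_le[of P q degree] that by (simp add: P_def)
  qed
qed

text \<open>Cancel the factor \<open>x - c\<close> of \<open>p\<close>: by minimality the quotient
  \<open>q\<close> leaves \<open>q(A) v\<close> nonzero, and \<open>A - c\<close> kills that
  vector.\<close>

lemma root_of_minimal_poly_is_eigenvalue:
  fixes A :: "'a::field^'n^'n"
  assumes p: "p \<noteq> 0" "poly_act A p v = 0"
    and min: "\<And>q. q \<noteq> 0 \<Longrightarrow> poly_act A q v = 0 \<Longrightarrow> degree p \<le> degree q"
    and root: "poly p c = 0"
  shows "\<exists>z. z \<noteq> 0 \<and> A *v z = c *s z"
proof -
  obtain q where q: "p = [:-c, 1:] * q"
    using root by (auto simp: poly_eq_0_iff_dvd)
  then have "q \<noteq> 0" using p by auto
  then have "degree p = Suc (degree q)"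
    unfolding q by (subst degree_mult_eq) auto
  then have "poly_act A q v \<noteq> 0"
    using min[OF \<open>q \<noteq> 0\<close>] by fastforce
  moreover have "A *v poly_act A q v = c *s poly_act A q v"
    using p(2) unfolding q poly_act_mult by (simp add: add_eq_0_iff2)
  ultimately show ?thesis by blast
qed

text \<open>Makes the \<open>Max\<close> in \<open>spectral_radius\<close> meaningful. The product
  of annihilating polynomials of the basis vectors annihilates every vector, so each eigenvalue is
  one of its finitely many roots.\<close>

lemma finite_eigenvalues: "finite (eigenvalues A)"
proof -
  define B where "B = cmat A"
  have "\<exists>p. p \<noteq> 0 \<and> poly_act B p (axis i 1) = 0" for i
    using annihilating_poly_exists[of B "axis i 1"] by metis
  then obtain p where p: "\<And>i. p i \<noteq> 0" "\<And>i. poly_act B (p i) (axis i 1) = 0"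
    by metis
  define q where "q = (\<Prod>i\<in>UNIV. p i)"
  have ax: "poly_act B q (axis i 1) = 0" for i
  proof -
    have "q = (\<Prod>j\<in>UNIV - {i}. p j) * p i"
      unfolding q_def by (subst prod.remove[of _ i]) (auto simp: mult.commute)
    then show ?thesis by (simp add: poly_act_mult p)
  qed
  have "poly_act B q (\<Sum>i\<in>I. z $ i *s axis i 1) = 0" if "finite I" for I and z :: "complex^'a"
    using that by (induction I rule: finite_induct) (simp_all add: poly_act_add_right poly_act_scale_right ax)
  then have all0: "poly_act B q z = 0" for z
    using basis_expansion[of z] by (metis finite)
  have "eigenvalues A \<subseteq> {c. poly q c = 0}"
  proof
    fix c assume "c \<in> eigenvalues A"
    then obtain z where "z \<noteq> 0" "B *v z = c *s z"
      by (auto simp: eigenvalues_def B_def)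
    then show "c \<in> {c. poly q c = 0}"
      using poly_act_eigenvector[of B z c q] all0 by (simp add: vector_mul_eq_0)
  qed
  moreover have "q \<noteq> 0" using p by (simp add: q_def)
  ultimately show ?thesis
    using poly_roots_finite finite_subset by blast
qed

section \<open>Exponential growth of matrix powers\<close>

lemma norm_vector_scalar_mult: "norm (c *s (v::complex^'n)) = cmod c * norm v"
  by (simp add: norm_vec_def norm_mult L2_set_right_distrib)

text \<open>Induction over the linear factors of \<open>p\<close>. With \<open>w = (A - c) v\<close>
  the iterates obey \<open>A ^ (k+1) v = c A ^ k v + A ^ k w\<close>. The quotient of
  \<open>p\<close> by \<open>x - c\<close> annihilates \<open>w\<close>, so the last term is
  \<open>O(s ^ k)\<close>, and \<open>cmod c < s\<close> preserves this order.\<close>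

lemma power_growth_bound:
  fixes A :: "complex^'n^'n"
  assumes "p \<noteq> 0" "poly_act A p v = 0" "\<And>c. poly p c = 0 \<Longrightarrow> cmod c < s" "s > 0"
  shows "\<exists>K\<ge>0. \<forall>k. norm ((((*v) A) ^^ k) v) \<le> K * s ^ k"
  using assms(1-3)
proof (induction "degree p" arbitrary: p v)
  case 0
  then obtain a where "p = [:a:]" "a \<noteq> 0"
    using degree_eq_zeroE by (metis pCons_0_0)
  then have "v = 0" using 0 by (simp add: vector_mul_eq_0)
  then have "(((*v) A) ^^ k) v = 0" for k by (induction k) auto
  then show ?case by (intro exI[of _ 0]) simp
next
  case (Suc n)
  then have "\<not> constant (poly p)" by (simp add: constant_degree)
  then obtain c where c: "poly p c = 0"
    using fundamental_theorem_of_algebra by blast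
  then obtain q where q: "p = [:-c, 1:] * q"
    by (auto simp: poly_eq_0_iff_dvd)
  define w where "w = poly_act A [:-c, 1:] v"
  have qn: "q \<noteq> 0" using Suc.prems q by auto
  have "degree p = Suc (degree q)"
    using qn unfolding q by (subst degree_mult_eq) auto
  moreover have "poly_act A q w = 0"
    using Suc.prems unfolding q w_def poly_act_mult[symmetric] by (simp add: mult.commute)
  ultimately obtain K where K: "K \<ge> 0" "\<And>k. norm ((((*v) A) ^^ k) w) \<le> K * s ^ k"
    using Suc.hyps(1)[of q w] Suc.hyps(2) Suc.prems qn q by auto
  have cs: "cmod c < s" using Suc.prems c by blast
  \<comment> \<open>The smallest constant that serves both the start, \<open>norm v \<le> L\<close>,
    and the induction step, \<open>cmod c * L + K \<le> L * s\<close>.\<close>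
  define L where "L = max (norm v) (K / (s - cmod c))"
  have L0: "L \<ge> 0" by (simp add: L_def le_max_iff_disj)
  have "K / (s - cmod c) \<le> L" by (simp add: L_def)
  then have LK: "cmod c * L + K \<le> L * s"
    using cs by (simp add: field_simps)
  have step: "(((*v) A) ^^ Suc k) v = c *s (((*v) A) ^^ k) v + (((*v) A) ^^ k) w" for k
  proof (induction k)
    case 0 then show ?case by (simp add: w_def)
  next
    case (Suc k)
    have "(((*v) A) ^^ Suc (Suc k)) v = A *v (c *s (((*v) A) ^^ k) v + (((*v) A) ^^ k) w)"
      using arg_cong[OF Suc, of "(*v) A"] by simp
    then show ?case
      by (simp add: matrix_vector_right_distrib vector_scalar_commute)
  qed
  have "norm ((((*v) A) ^^ k) v) \<le> L * s ^ k" for k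
  proof (induction k)
    case 0 then show ?case by (simp add: L_def)
  next
    case (Suc k)
    have "norm ((((*v) A) ^^ Suc k) v) \<le> cmod c * norm ((((*v) A) ^^ k) v) + norm ((((*v) A) ^^ k) w)"
      unfolding step by (metis norm_triangle_ineq norm_vector_scalar_mult)
    also have "\<dots> \<le> cmod c * (L * s ^ k) + K * s ^ k"
      by (intro add_mono mult_left_mono Suc K) auto
    also have "\<dots> = (cmod c * L + K) * s ^ k" by (simp add: algebra_simps)
    also have "\<dots> \<le> (L * s) * s ^ k"
      using LK \<open>s > 0\<close> by (intro mult_right_mono) auto
    finally show ?case by (simp add: algebra_simps)
  qed
  then show ?case using L0 by blast
qed

section \<open>Real matrices viewed over the complex numbers\<close>

lemma complex_of_real_vector_scale: "complex_of_real r *s (v::complex^'n) = r *\<^sub>R v"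
  unfolding vec_eq_iff vector_scaleR_component by (simp add: scaleR_conv_of_real[where 'a = complex])

lemma matrix_vector_mult_scaleR_complex:
  "(A::complex^'n^'n) *v (r *\<^sub>R v) = r *\<^sub>R (A *v v)"
  by (simp flip: complex_of_real_vector_scale add: vector_scalar_commute)

lemma matrix_vector_mult_sum: "A *v (\<Sum>i\<in>I. f i) = (\<Sum>i\<in>I. A *v f i)"
  by (induction I rule: infinite_finite_induct) (simp_all add: matrix_vector_right_distrib)

definition cvec :: "real^'n \<Rightarrow> complex^'n" where
  "cvec u = (\<chi> i. complex_of_real (u $ i))"

lemma cvec_nth [simp]: "cvec u $ i = complex_of_real (u $ i)"
  by (simp add: cvec_def)

lemma cvec_eq_iff: "cvec u = cvec v \<longleftrightarrow> u = v"
  by (simp add: vec_eq_iff)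

lemma cvec_eq_0_iff [simp]: "cvec u = 0 \<longleftrightarrow> u = 0"
  by (simp add: vec_eq_iff)

lemma cmat_mult_cvec: "cmat A *v cvec u = cvec (A *v u)"
  by (simp add: vec_eq_iff cmat_def matrix_vector_mult_def)

lemma cmat_funpow_cvec: "(((*v) (cmat A)) ^^ k) (cvec u) = cvec ((((*v) A) ^^ k) u)"
  by (induction k) (simp_all add: cmat_mult_cvec)

section \<open>Nonnegative matrices and comparison of vectors\<close>

lemma mult_vector_mono:
  fixes A :: "real^'n^'m"
  assumes "\<And>i j. A $ i $ j \<ge> 0" "\<And>j. x $ j \<le> y $ j"
  shows "(A *v x) $ i \<le> (A *v y) $ i"
  by (auto simp: matrix_vector_mult_def intro!: sum_mono mult_left_mono assms)

lemma mult_vector_nonneg: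
  fixes A :: "real^'n^'m"
  assumes "\<And>i j. A $ i $ j \<ge> 0" "\<And>j. x $ j \<ge> 0"
  shows "(A *v x) $ i \<ge> 0"
  by (auto simp: matrix_vector_mult_def intro!: sum_nonneg mult_nonneg_nonneg assms)

lemma funpow_mult_vector_nonneg:
  fixes A :: "real^'n^'n"
  assumes "\<And>i j. A $ i $ j \<ge> 0" "\<And>j. x $ j \<ge> 0"
  shows "((((*v) A) ^^ k) x) $ i \<ge> 0"
  by (induction k arbitrary: i) (auto intro!: mult_vector_nonneg assms)

lemma funpow_mult_vector_mono:
  fixes A :: "real^'n^'n"
  assumes "\<And>i j. A $ i $ j \<ge> 0" "\<And>j. x $ j \<le> y $ j"
  shows "((((*v) A) ^^ k) x) $ i \<le> ((((*v) A) ^^ k) y) $ i"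
  by (induction k arbitrary: i) (auto intro!: mult_vector_mono assms)

lemma funpow_mult_vector_scale:
  fixes A :: "real^'n^'n"
  shows "(((*v) A) ^^ k) (c *s x) = c *s (((*v) A) ^^ k) x"
  by (induction k) (simp_all add: vector_scalar_commute)

text \<open>If \<open>y \<le> c u\<close>, then
  \<open>t ^ k y \<le> A ^ k y \<le> c A ^ k u \<le> c K s ^ k\<close>, so at a positive entry of
  \<open>y\<close> the powers of \<open>t / s\<close> stay bounded.\<close>

lemma subinvariant_vector_growth:
  fixes A :: "real^'n^'n"
  assumes A: "\<And>i j. A $ i $ j \<ge> 0" and u: "\<And>i. u $ i > 0"
    and y: "\<And>i. y $ i \<ge> 0" "y \<noteq> 0" and t: "t \<ge> 0" "\<And>i. t * y $ i \<le> (A *v y) $ i"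
    and s: "s > 0" and K: "\<And>k i. ((((*v) A) ^^ k) u) $ i \<le> K * s ^ k"
  shows "t \<le> s"
proof (rule ccontr)
  assume "\<not> t \<le> s"
  then have ts: "t / s > 1" using s by simp
  obtain i where i: "y $ i > 0"
    using y by (metis order_le_less vec_eq_iff zero_index)
  \<comment> \<open>The sum is at least each single ratio, whence
    \<open>y \<le> c u\<close>.\<close>
  define c where "c = (\<Sum>j\<in>UNIV. y $ j / u $ j)"
  have c0: "c \<ge> 0" unfolding c_def by (intro sum_nonneg divide_nonneg_pos y u)
  have yc: "y $ j \<le> (c *s u) $ j" for j
  proof -
    have "y $ j / u $ j \<le> c"
      unfolding c_def using y u by (intro member_le_sum) (auto intro!: divide_nonneg_pos)
    then show ?thesis using u[of j] by (simp add: field_simps)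
  qed
  have low: "t ^ k * y $ j \<le> ((((*v) A) ^^ k) y) $ j" for k j
  proof (induction k arbitrary: j)
    case (Suc k)
    have "t ^ Suc k * y $ j \<le> t ^ k * (A *v y) $ j"
      using mult_left_mono[OF t(2)[of j], of "t ^ k"] t(1) by (simp add: algebra_simps)
    also have "\<dots> = (A *v (t ^ k *s y)) $ j"
      by (simp add: vector_scalar_commute)
    also have "\<dots> \<le> ((((*v) A) ^^ Suc k) y) $ j"
      using Suc by (auto intro!: mult_vector_mono A)
    finally show ?case .
  qed simp
  have "(t / s) ^ k \<le> c * K / y $ i" for k
  proof -
    have "t ^ k * y $ i \<le> c * ((((*v) A) ^^ k) u) $ i"
      using order_trans[OF low[of k i] funpow_mult_vector_mono[OF A yc, of k i]]
      by (simp add: funpow_mult_vector_scale)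
    also have "\<dots> \<le> c * (K * s ^ k)"
      by (intro mult_left_mono K c0)
    finally show ?thesis using i s by (simp add: field_simps)
  qed
  moreover obtain k where "c * K / y $ i < (t / s) ^ k"
    using real_arch_pow[OF ts] by blast
  ultimately show False by (meson not_le)
qed

text \<open>Subtracting the identity before taking absolute values gives the bound
  \<open>1 + \<bar>c - 1\<bar>\<close> in place of \<open>\<bar>c\<bar>\<close>; this is what excludes further eigenvalues of maximal modulus.\<close>
lemma eigenvector_modulus_subinvariant:
  fixes A :: "real^'n^'n"
  assumes A: "\<And>i j. A $ i $ j \<ge> 0" "\<And>i. A $ i $ i \<ge> 1"
    and z: "cmat A *v z = c *s z"
  shows "(1 + cmod (c - 1)) * cmod (z $ i) \<le> (A *v (\<chi> j. cmod (z $ j))) $ i"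
proof -
  define N where "N j = A $ i $ j - (if i = j then 1 else 0)" for j
  have N: "N j \<ge> 0" for j using A(1)[of i j] A(2)[of i] by (auto simp: N_def)
  have "(c - 1) * z $ i = (cmat A *v z) $ i - z $ i"
    by (simp add: z algebra_simps)
  also have "\<dots> = (\<Sum>j\<in>UNIV. complex_of_real (N j) * z $ j)"
    by (simp add: N_def cmat_def matrix_vector_mult_def left_diff_distrib sum_subtractf
        if_distrib[of complex_of_real] if_distrib[of "\<lambda>x. x * _"] cong: if_cong)
  also have "cmod \<dots> \<le> (\<Sum>j\<in>UNIV. N j * cmod (z $ j))"
    by (rule order_trans[OF norm_sum]) (simp add: norm_mult N)
  also have "\<dots> = (A *v (\<chi> j. cmod (z $ j))) $ i - cmod (z $ i)"
    by (simp add: N_def matrix_vector_mult_def left_diff_distrib sum_subtractf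
        if_distrib[of "\<lambda>x. x * _"] cong: if_cong)
  finally show ?thesis unfolding norm_mult by (simp add: algebra_simps)
qed

text \<open>The equality case of the triangle inequality
  \<open>cmod c \<le> 1 + cmod (c - 1)\<close>.\<close>

lemma one_plus_cmod_le_imp_real:
  assumes "1 + cmod (c - 1) \<le> cmod c"
  shows "c = complex_of_real (cmod c)" "cmod c \<ge> 1"
proof -
  have "(1 + cmod (c - 1))\<^sup>2 \<le> (cmod c)\<^sup>2"
    using assms by (intro power_mono) auto
  \<comment> \<open>Since \<open>cmod c ^ 2 = cmod (c - 1) ^ 2 + 2 * Re c - 1\<close>, the quadratic
    terms cancel. Squaring the outcome once more isolates \<open>Im c\<close>.\<close>
  then have le: "cmod (c - 1) \<le> Re c - 1"
    by (simp add: power2_sum cmod_power2 power2_diff)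
  then have "(cmod (c - 1))\<^sup>2 \<le> (Re c - 1)\<^sup>2"
    by (intro power_mono) auto
  then have "Im c = 0" by (simp add: cmod_power2)
  moreover have "Re c \<ge> 1" using le norm_ge_zero[of "c - 1"] by linarith
  ultimately show "c = complex_of_real (cmod c)"
    by (simp add: complex_eq_iff cmod_def)
  show "cmod c \<ge> 1" using assms norm_ge_zero[of "c - 1"] by linarith
qed

section \<open>Asymptotics along a Jordan chain\<close>

text \<open>The binomial expansion of \<open>(R + N) ^ k\<close> with \<open>N = A - R\<close> and
  \<open>w j = N ^ j (w 0)\<close>. Writing \<open>R ^ k / R ^ j\<close> avoids truncated
  subtraction; for \<open>j > k\<close> the binomial coefficient vanishes.\<close>

lemma funpow_jordan_chain:
  fixes A :: "complex^'n^'n"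
  assumes w: "\<And>j. A *v w j = R *\<^sub>R w j + w (Suc j)" and wd: "w (Suc d) = 0" and R: "R > 0"
  shows "(((*v) A) ^^ k) (w 0) = (\<Sum>j\<le>d. (real (k choose j) * R ^ k / R ^ j) *\<^sub>R w j)"
proof (induction k)
  case 0
  have "(\<Sum>j\<le>d. (real (0 choose j) * R ^ 0 / R ^ j) *\<^sub>R w j) = (\<Sum>j\<in>{0}. (real (0 choose j) * R ^ 0 / R ^ j) *\<^sub>R w j)"
    by (rule sum.mono_neutral_right) auto
  then show ?case by simp
next
  case (Suc k)
  define c where "c k j = real (k choose j) * R ^ k / R ^ j" for k j
  \<comment> \<open>Pascal's rule.\<close>
  have c_step: "c (Suc k) (Suc j) = R * c k (Suc j) + c k j" for j
    using R by (simp add: c_def field_simps)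
  have c_0: "c (Suc k) 0 = R * c k 0" by (simp add: c_def)
  \<comment> \<open>The shifted sum has one extra term, at \<open>Suc d\<close>, which is zero
    because the chain ends there.\<close>
  have ext: "(\<Sum>j\<le>d. f j *\<^sub>R w j) = f 0 *\<^sub>R w 0 + (\<Sum>j\<le>d. f (Suc j) *\<^sub>R w (Suc j))" for f :: "nat \<Rightarrow> real"
    using sum.atMost_Suc_shift[of "\<lambda>j. f j *\<^sub>R w j" d] wd by simp
  have "(((*v) A) ^^ Suc k) (w 0) = A *v (\<Sum>j\<le>d. c k j *\<^sub>R w j)"
    using Suc by (simp add: c_def)
  also have "\<dots> = (\<Sum>j\<le>d. c k j *\<^sub>R (R *\<^sub>R w j + w (Suc j)))"
    by (simp add: matrix_vector_mult_sum matrix_vector_mult_scaleR_complex w)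
  also have "\<dots> = (\<Sum>j\<le>d. (R * c k j) *\<^sub>R w j) + (\<Sum>j\<le>d. c k j *\<^sub>R w (Suc j))"
    by (simp add: scaleR_add_right sum.distrib mult.commute)
  also have "\<dots> = c (Suc k) 0 *\<^sub>R w 0 + (\<Sum>j\<le>d. c (Suc k) (Suc j) *\<^sub>R w (Suc j))"
    unfolding ext[of "\<lambda>j. R * c k j"] c_step c_0 by (simp add: scaleR_add_left sum.distrib)
  also have "\<dots> = (\<Sum>j\<le>d. c (Suc k) j *\<^sub>R w j)"
    by (rule ext[symmetric])
  finally show ?case by (simp add: c_def)
qed

text \<open>The binomial coefficient is a product of \<open>j\<close> factors \<open>k - i\<close>
  over \<open>fact j\<close>, and each factor divided by \<open>k\<close> tends to 1.\<close>

lemma binomial_over_power_tendsto: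
  "(\<lambda>k. real (k choose j) / real k ^ j) \<longlonglongrightarrow> 1 / fact j"
proof -
  have lim: "(\<lambda>k. (\<Prod>i<j. 1 - real i / real k) / fact j) \<longlonglongrightarrow> (\<Prod>i<j. 1 - 0) / fact j"
    by (intro tendsto_intros lim_const_over_n) auto
  have "eventually (\<lambda>k. (\<Prod>i<j. 1 - real i / real k) / fact j = real (k choose j) / real k ^ j) sequentially"
    using eventually_gt_at_top[of 0]
  proof eventually_elim
    fix k :: nat assume k: "k > 0"
    have "(\<Prod>i<j. 1 - real i / real k) = (\<Prod>i<j. (real k - real i) / real k)"
      using k by (intro prod.cong) (auto simp: field_simps)
    also have "\<dots> = (\<Prod>i<j. real k - real i) / real k ^ j"
      by (simp add: prod_dividef)
    finally show "(\<Prod>i<j. 1 - real i / real k) / fact j = real (k choose j) / real k ^ j"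
      by (simp add: binomial_gbinomial gbinomial_prod_rev atLeast0LessThan)
  qed
  from Lim_transform_eventually[OF lim this] show ?thesis by simp
qed

lemma binomial_over_larger_power_tendsto:
  assumes "j < d"
  shows "(\<lambda>k. real (k choose j) / real k ^ d) \<longlonglongrightarrow> 0"
proof -
  have "(\<lambda>k. real (k choose j) / real k ^ j * (1 / real k) ^ (d - j)) \<longlonglongrightarrow> 1 / fact j * 0 ^ (d - j)"
    by (intro tendsto_mult binomial_over_power_tendsto tendsto_power lim_const_over_n)
  moreover have "real (k choose j) / real k ^ j * (1 / real k) ^ (d - j) = real (k choose j) / real k ^ d" for k
    using assms power_add[of "real k" j "d - j"] by (simp add: power_one_over field_simps)
  ultimately show ?thesis using assms by (simp add: power_0_left)
qed

section \<open>Convergence of the scaled power iteration\<close>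

text \<open>The start vector is arbitrary positive so that both the all-ones vector and
  \<open>B 1\<close> qualify. Positivity of \<open>h\<close> is claimed for \<open>k > 0\<close>
  only, since the scale \<open>R ^ k * k ^ d\<close> may vanish at 0.\<close>

lemma positive_power_iteration:
  fixes A :: "real^'n^'n"
  assumes A: "\<And>i j. A $ i $ j \<ge> 0" "\<And>i. A $ i $ i \<ge> 1" and u: "\<And>i. u $ i > 0"
  obtains R g h where "R \<ge> (1::real)" "\<And>k. k > 0 \<Longrightarrow> h k > (0::real)"
    "(\<lambda>k. (1 / h k) *\<^sub>R (((*v) A) ^^ k) u) \<longlonglongrightarrow> g" "g \<noteq> 0" "A *v g = R *s g"
    "\<And>c. c \<in> eigenvalues A \<Longrightarrow> cmod c \<le> R"
proof -
  define B where "B = cmat A"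
  define v where "v = cvec u"
  have "u \<noteq> 0" using u by (metis less_irrefl zero_index)
  then have v0: "v \<noteq> 0" by (simp add: v_def)
  obtain p where p: "p \<noteq> 0" "poly_act B p v = 0"
    and p_min: "\<And>q. q \<noteq> 0 \<Longrightarrow> poly_act B q v = 0 \<Longrightarrow> degree p \<le> degree q"
    using minimal_annihilating_poly_exists[of B v] by metis
  define Z where "Z = {c. poly p c = 0}"
  have finZ: "finite Z" unfolding Z_def using p(1) by (rule poly_roots_finite)
  have "degree p \<noteq> 0"
  proof
    assume "degree p = 0"
    then obtain a where a: "p = [:a:]" using degree_eq_zeroE by blast
    then show False using p v0 by (simp add: vector_mul_eq_0)
  qed
  then have "Z \<noteq> {}"
    using fundamental_theorem_of_algebra[of p] by (auto simp: Z_def constant_degree)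
  define R where "R = Max (cmod ` Z)"
  have Zle: "cmod c \<le> R" if "c \<in> Z" for c
    using that finZ by (simp add: R_def)
  have "R \<in> cmod ` Z"
    unfolding R_def using finZ \<open>Z \<noteq> {}\<close> by (intro Max_in) auto
  then obtain c0 where c0: "c0 \<in> Z" "cmod c0 = R" by auto
  \<comment> \<open>The growth bound needs \<open>s\<close> strictly above all roots of
    \<open>p\<close>, so the inequality is proved for every \<open>s > R\<close> and passes to
    \<open>R\<close> by density. It covers all eigenvectors of \<open>B\<close>, not only those
    arising from \<open>p\<close>.\<close>
  have eig: "1 + cmod (c - 1) \<le> R" if "z \<noteq> 0" "B *v z = c *s z" for c z
  proof (rule dense_ge)
    fix s assume "R < s"
    moreover have "R \<ge> 0" using c0 by auto
    ultimately have s: "s > 0" by simp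
    obtain K where K: "\<And>k. norm ((((*v) B) ^^ k) v) \<le> K * s ^ k"
      using power_growth_bound[OF p _ s] Zle \<open>R < s\<close> by (force simp: Z_def)
    have "((((*v) A) ^^ k) u) $ i \<le> K * s ^ k" for k i
    proof -
      have "((((*v) A) ^^ k) u) $ i \<le> cmod (((((*v) B) ^^ k) v) $ i)"
        by (simp add: B_def v_def cmat_funpow_cvec)
      also have "\<dots> \<le> norm ((((*v) B) ^^ k) v)" by (rule Finite_Cartesian_Product.norm_nth_le)
      finally show ?thesis using K[of k] by simp
    qed
    moreover have "(\<chi> j. cmod (z $ j)) \<noteq> 0"
      using that(1) by (simp add: vec_eq_iff)
    moreover have "(1 + cmod (c - 1)) * (\<chi> j. cmod (z $ j)) $ i \<le> (A *v (\<chi> j. cmod (z $ j))) $ i" for i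
      using eigenvector_modulus_subinvariant[OF A, of z c i] that(2) by (simp add: B_def)
    ultimately show "1 + cmod (c - 1) \<le> s"
      using subinvariant_vector_growth[OF A(1) u, of "\<chi> j. cmod (z $ j)" "1 + cmod (c - 1)" s K] s
      by simp
  qed
  have Zeig: "1 + cmod (c - 1) \<le> R" if "c \<in> Z" for c
    using root_of_minimal_poly_is_eigenvalue[OF p p_min, of c] that eig by (auto simp: Z_def)
  \<comment> \<open>For a root of modulus \<open>R\<close> the bound reads
    \<open>1 + cmod (c - 1) \<le> cmod c\<close>, which forces \<open>c\<close> to be real and
    positive.\<close>
  have unique: "c = complex_of_real R" if "c \<in> Z" "cmod c = R" for c
    using one_plus_cmod_le_imp_real(1)[of c] Zeig[OF that(1)] that(2) by simp
  have R1: "R \<ge> 1"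
    using Zeig[OF c0(1)] norm_ge_zero[of "c0 - 1"] by linarith
  have eig_le: "cmod c \<le> R" if c: "c \<in> eigenvalues A" for c
  proof -
    obtain z where "z \<noteq> 0" "B *v z = c *s z"
      using c by (auto simp: eigenvalues_def B_def)
    then have "1 + cmod (c - 1) \<le> R" by (rule eig)
    moreover have "cmod c \<le> 1 + cmod (c - 1)"
      using norm_triangle_ineq[of 1 "c - 1"] by simp
    ultimately show ?thesis by linarith
  qed

  define l where "l = [:- complex_of_real R, 1:]"
  define m where "m = order (complex_of_real R) p"
  have rootR: "poly p (complex_of_real R) = 0"
    using c0 unique[OF c0] by (simp add: Z_def)
  obtain q where q: "p = l ^ m * q" "\<not> l dvd q"
    using order_decomp[OF p(1), of "complex_of_real R"] unfolding l_def m_def by blast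
  have m0: "m \<noteq> 0" using rootR p(1) by (simp add: m_def order_root)
  have qn: "q \<noteq> 0" using q p by auto
  have "coprime (l ^ m) q"
    using q(2) by (intro coprime_power_left_iff[THEN iffD2] disjI1 prime_elem_imp_coprime)
       (simp_all add: l_def prime_elem_linear_field_poly)
  then obtain a b where ab: "a * l ^ m + b * q = 1"
    by (metis bezout_coefficients_fst_snd coprime_imp_gcd_eq_1)
  \<comment> \<open>The Bezout identity splits \<open>v\<close>: \<open>v1\<close> is a generalised
    eigenvector for \<open>R\<close>, and \<open>v2\<close> is annihilated by \<open>q\<close>,
    whose roots are all smaller than \<open>R\<close> in modulus.\<close>
  define v1 where "v1 = poly_act B (b * q) v"
  define v2 where "v2 = poly_act B (a * l ^ m) v"
  have split: "v = v1 + v2"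
    unfolding v1_def v2_def poly_act_add[symmetric] by (simp add: add.commute[of "b * q"] ab)
  have bq: "l ^ m * (b * q) = b * p" and al: "q * (a * l ^ m) = a * p"
    by (simp_all add: q mult_ac)
  have kill1: "poly_act B (l ^ m) v1 = 0"
    unfolding v1_def poly_act_mult[symmetric] bq by (simp add: poly_act_mult p(2))
  have kill2: "poly_act B q v2 = 0"
    unfolding v2_def poly_act_mult[symmetric] al by (simp add: poly_act_mult p(2))
  have "degree l = 1" by (simp add: l_def)
  \<comment> \<open>Otherwise \<open>q\<close>, of degree smaller by \<open>m\<close>, would already
    annihilate \<open>v\<close>.\<close>
  have "v1 \<noteq> 0"
  proof
    assume "v1 = 0"
    then have "degree p \<le> degree q" using p_min[OF qn] kill2 split by simp
    moreover have "degree p = m + degree q"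
      unfolding q(1) using qn \<open>degree l = 1\<close>
      by (subst degree_mult_eq) (auto simp: degree_power_eq l_def)
    ultimately show False using m0 by simp
  qed

  \<comment> \<open>Inserting 0 keeps \<open>Max\<close> defined when \<open>q\<close> is constant.
    The midpoint \<open>s\<close> then lies strictly between the roots of \<open>q\<close> and
    \<open>R\<close>, and is positive.\<close>
  define r where "r = Max (insert 0 (cmod ` {c. poly q c = 0}))"
  define s where "s = (r + R) / 2"
  have finq: "finite {c. poly q c = 0}" using qn by (rule poly_roots_finite)
  have qlt: "cmod c < R" if "poly q c = 0" for c
  proof -
    have "c \<in> Z" using that by (simp add: Z_def q)
    moreover have "c \<noteq> complex_of_real R"
      using q(2) that by (auto simp: l_def poly_eq_0_iff_dvd)
    ultimately show ?thesis using Zle unique by force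
  qed
  have r: "0 \<le> r" "r < R" "\<And>c. poly q c = 0 \<Longrightarrow> cmod c \<le> r"
    unfolding r_def using finq qlt R1 by auto
  have s: "0 < s" "s < R" "\<And>c. poly q c = 0 \<Longrightarrow> cmod c < s"
    using r R1 by (force simp: s_def)+
  obtain K where K: "\<And>k. norm ((((*v) B) ^^ k) v2) \<le> K * s ^ k"
    using power_growth_bound[OF qn kill2 s(3) s(1)] by blast

  define w where "w j = poly_act B (l ^ j) v1" for j
  have w_step: "B *v w j = R *\<^sub>R w j + w (Suc j)" for j
  proof -
    have "w (Suc j) = poly_act B l (w j)"
      unfolding w_def power_Suc poly_act_mult ..
    then show ?thesis by (simp add: l_def flip: complex_of_real_vector_scale)
  qed
  have wm: "w m = 0" using kill1 by (simp add: w_def)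
  \<comment> \<open>The last nonzero link of the chain, at \<open>d = n - 1\<close>, is a true
    eigenvector; \<open>n\<close> is positive because \<open>w 0 = v1\<close> is nonzero.\<close>
  define n where "n = (LEAST n. w n = 0)"
  have "w n = 0" unfolding n_def using wm by (rule LeastI)
  moreover have "w 0 = v1" by (simp add: w_def)
  ultimately obtain d where d: "n = Suc d"
    using \<open>v1 \<noteq> 0\<close> by (cases n) auto
  have wd: "w d \<noteq> 0" using not_less_Least[of d "\<lambda>n. w n = 0"] d by (auto simp: n_def)
  have wSd: "w (Suc d) = 0" using \<open>w n = 0\<close> d by simp
  have Bwd: "B *v w d = R *\<^sub>R w d" using w_step[of d] wSd by simp

  \<comment> \<open>The term \<open>j = d\<close> dominates the expansion: \<open>k choose d\<close>
    behaves like \<open>k ^ d / fact d\<close>, so \<open>h\<close> is its order of growth and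
    \<open>e\<close> the remaining constant.\<close>
  define h where "h k = R ^ k * real k ^ d" for k
  define e where "e = 1 / (fact d * R ^ d)"
  have e0: "e > 0" using R1 by (simp add: e_def)
  have lim1: "(\<lambda>k. (1 / h k) *\<^sub>R (((*v) B) ^^ k) v1) \<longlonglongrightarrow> e *\<^sub>R w d"
  proof -
    have "(\<lambda>k. \<Sum>j\<le>d. (real (k choose j) / real k ^ d / R ^ j) *\<^sub>R w j)
        \<longlonglongrightarrow> (\<Sum>j\<le>d. ((if j = d then 1 / fact d else 0) / R ^ j) *\<^sub>R w j)"
    proof (intro tendsto_sum tendsto_scaleR tendsto_divide tendsto_const)
      fix j assume "j \<in> {..d}"
      then show "(\<lambda>k. real (k choose j) / real k ^ d) \<longlonglongrightarrow> (if j = d then 1 / fact d else 0)"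
        using binomial_over_power_tendsto[of d] binomial_over_larger_power_tendsto[of j d] by auto
    qed (use R1 in auto)
    also have "(\<Sum>j\<le>d. ((if j = d then 1 / fact d else 0) / R ^ j) *\<^sub>R w j) = (\<Sum>j\<le>d. if j = d then e *\<^sub>R w d else 0)"
      by (intro sum.cong) (auto simp: e_def)
    also have "\<dots> = e *\<^sub>R w d" by simp
    finally have "(\<lambda>k. \<Sum>j\<le>d. (real (k choose j) / real k ^ d / R ^ j) *\<^sub>R w j) \<longlonglongrightarrow> e *\<^sub>R w d" .
    moreover have "(1 / h k) *\<^sub>R (((*v) B) ^^ k) v1 = (\<Sum>j\<le>d. (real (k choose j) / real k ^ d / R ^ j) *\<^sub>R w j)" for k
    proof -
      have "(1 / h k) *\<^sub>R (((*v) B) ^^ k) v1 = (\<Sum>j\<le>d. (1 / h k) *\<^sub>R (real (k choose j) * R ^ k / R ^ j) *\<^sub>R w j)"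
        using funpow_jordan_chain[where w = w and R = R and d = d and A = B, OF w_step wSd] R1 \<open>w 0 = v1\<close>
        by (simp add: scaleR_sum_right)
      also have "\<dots> = (\<Sum>j\<le>d. (real (k choose j) / real k ^ d / R ^ j) *\<^sub>R w j)"
        using R1 by (intro sum.cong) (auto simp: h_def)
      finally show ?thesis .
    qed
    ultimately show ?thesis by simp
  qed
  have lim2: "(\<lambda>k. (1 / h k) *\<^sub>R (((*v) B) ^^ k) v2) \<longlonglongrightarrow> 0"
  proof (rule Lim_null_comparison)
    show "(\<lambda>k. K * (s / R) ^ k) \<longlonglongrightarrow> 0"
      using s R1 by (intro tendsto_mult_right_zero LIMSEQ_power_zero) auto
    show "\<forall>\<^sub>F k in sequentially. norm ((1 / h k) *\<^sub>R (((*v) B) ^^ k) v2) \<le> K * (s / R) ^ k"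
      using eventually_gt_at_top[of 0]
    proof eventually_elim
      fix k :: nat assume k: "k > 0"
      have Rk: "0 < R ^ k" using R1 by simp
      have "R ^ k * 1 \<le> h k"
        unfolding h_def using k Rk by (intro mult_left_mono one_le_power) auto
      then have hk: "R ^ k \<le> h k" by simp
      have "norm ((1 / h k) *\<^sub>R (((*v) B) ^^ k) v2) = norm ((((*v) B) ^^ k) v2) / h k"
        using hk Rk by simp
      also have "\<dots> \<le> norm ((((*v) B) ^^ k) v2) / R ^ k"
        using hk Rk by (intro divide_left_mono) auto
      also have "\<dots> \<le> K * s ^ k / R ^ k"
        using K Rk by (intro divide_right_mono) auto
      finally show "norm ((1 / h k) *\<^sub>R (((*v) B) ^^ k) v2) \<le> K * (s / R) ^ k"
        by (simp add: power_divide)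
    qed
  qed
  have add: "(((*v) B) ^^ k) v = (((*v) B) ^^ k) v1 + (((*v) B) ^^ k) v2" for k
    unfolding split by (induction k) (simp_all add: matrix_vector_right_distrib)
  have lim: "(\<lambda>k. (1 / h k) *\<^sub>R (((*v) B) ^^ k) v) \<longlonglongrightarrow> e *\<^sub>R w d"
    using tendsto_add[OF lim1 lim2] by (simp add: add scaleR_add_right)

  \<comment> \<open>All scaled iterates of \<open>v\<close> are real, so the limit has zero
    imaginary part and \<open>Re\<close> loses nothing.\<close>
  define g where "g = (\<chi> i. Re ((e *\<^sub>R w d) $ i))"
  have comp: "(\<lambda>k. complex_of_real (((1 / h k) *\<^sub>R (((*v) A) ^^ k) u) $ i)) \<longlonglongrightarrow> (e *\<^sub>R w d) $ i" for i
    using tendsto_vec_nth[OF lim, of i]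
    by (simp add: B_def v_def cmat_funpow_cvec scaleR_conv_of_real[where 'a = complex])
  have lim_g: "(\<lambda>k. (1 / h k) *\<^sub>R (((*v) A) ^^ k) u) \<longlonglongrightarrow> g"
  proof (rule vec_tendstoI)
    fix i
    show "(\<lambda>k. ((1 / h k) *\<^sub>R (((*v) A) ^^ k) u) $ i) \<longlonglongrightarrow> g $ i"
      using tendsto_Re[OF comp[of i]] by (simp add: g_def)
  qed
  have "Im ((e *\<^sub>R w d) $ i) = 0" for i
    using tendsto_Im[OF comp[of i]] by (simp add: LIMSEQ_const_iff)
  then have gw: "cvec g = e *\<^sub>R w d"
    by (simp add: vec_eq_iff g_def complex_eq_iff)
  show ?thesis
  proof (rule that[OF R1 _ lim_g _ _ eig_le])
    show "h k > 0" if "k > 0" for k using that R1 by (simp add: h_def)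
    show "g \<noteq> 0" using gw wd e0 by (metis cvec_eq_0_iff less_irrefl scaleR_eq_0_iff)
    have "cvec (A *v g) = cvec (R *s g)"
    proof -
      have "cvec (A *v g) = B *v cvec g" by (simp add: B_def cmat_mult_cvec)
      also have "\<dots> = R *\<^sub>R cvec g"
        by (simp add: gw matrix_vector_mult_scaleR_complex Bwd)
      finally show ?thesis by (simp add: vec_eq_iff scaleR_conv_of_real[where 'a = complex])
    qed
    then show "A *v g = R *s g" by (simp only: cvec_eq_iff)
  qed
qed

section \<open>Normalisation and principal eigenvectors\<close>

text \<open>Normalising cancels any positive factor, so \<open>h\<close> disappears for
  \<open>k > 0\<close>, and \<open>norm1\<close> is continuous and nonzero at
  \<open>g\<close>.\<close>

lemma normalized_tendsto:
  fixes v :: "nat \<Rightarrow> real^'n"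
  assumes nonneg: "\<And>k i. v k $ i \<ge> 0" and h: "\<And>k. k > 0 \<Longrightarrow> h k > (0::real)"
    and lim: "(\<lambda>k. (1 / h k) *\<^sub>R v k) \<longlonglongrightarrow> g" and g: "g \<noteq> 0"
  shows "(\<lambda>k. (1 / norm1 (v k)) *\<^sub>R v k) \<longlonglongrightarrow> (1 / norm1 g) *\<^sub>R g"
    and "\<And>i. ((1 / norm1 g) *\<^sub>R g) $ i \<ge> 0" "(\<Sum>i\<in>UNIV. ((1 / norm1 g) *\<^sub>R g) $ i) = 1"
proof -
  obtain i0 where "g $ i0 \<noteq> 0" using g by (metis vec_eq_iff zero_index)
  then have n0: "norm1 g > 0"
    unfolding norm1_def by (intro sum_pos2[of _ i0]) auto
  have "(\<lambda>k. norm1 ((1 / h k) *\<^sub>R v k)) \<longlonglongrightarrow> norm1 g"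
    unfolding norm1_def by (intro tendsto_sum tendsto_rabs tendsto_vec_nth lim)
  then have "(\<lambda>k. (1 / norm1 ((1 / h k) *\<^sub>R v k)) *\<^sub>R ((1 / h k) *\<^sub>R v k)) \<longlonglongrightarrow> (1 / norm1 g) *\<^sub>R g"
    using n0 by (intro tendsto_scaleR tendsto_divide tendsto_const lim) auto
  moreover have "\<forall>\<^sub>F k in sequentially. (1 / norm1 ((1 / h k) *\<^sub>R v k)) *\<^sub>R ((1 / h k) *\<^sub>R v k) = (1 / norm1 (v k)) *\<^sub>R v k"
    using eventually_gt_at_top[of 0]
  proof eventually_elim
    fix k :: nat assume "k > 0"
    then have hk: "h k > 0" by (rule h)
    then have "norm1 ((1 / h k) *\<^sub>R v k) = norm1 (v k) / h k"
      by (simp add: norm1_def abs_mult sum_divide_distrib)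
    then show "(1 / norm1 ((1 / h k) *\<^sub>R v k)) *\<^sub>R ((1 / h k) *\<^sub>R v k) = (1 / norm1 (v k)) *\<^sub>R v k"
      using hk by simp
  qed
  ultimately show "(\<lambda>k. (1 / norm1 (v k)) *\<^sub>R v k) \<longlonglongrightarrow> (1 / norm1 g) *\<^sub>R g"
    by (rule Lim_transform_eventually)
  have g0: "g $ i \<ge> 0" for i
  proof (rule tendsto_lowerbound[OF tendsto_vec_nth[OF lim]])
    show "\<forall>\<^sub>F k in sequentially. 0 \<le> ((1 / h k) *\<^sub>R v k) $ i"
      using eventually_gt_at_top[of 0]
      by eventually_elim (use h nonneg in \<open>simp add: less_imp_le\<close>)
  qed simp
  show "((1 / norm1 g) *\<^sub>R g) $ i \<ge> 0" for i
    using g0 n0 by simp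
  have "norm1 g = (\<Sum>i\<in>UNIV. g $ i)" using g0 by (simp add: norm1_def)
  then show "(\<Sum>i\<in>UNIV. ((1 / norm1 g) *\<^sub>R g) $ i) = 1"
    using n0 by (simp flip: sum_divide_distrib)
qed

text \<open>The vector \<open>g\<close> shows that the upper bound \<open>R\<close> is itself an
  eigenvalue, hence the maximum.\<close>

lemma principal_eigenvectorI:
  fixes A :: "real^'n^'n"
  assumes g: "g \<noteq> 0" "A *v g = R *s g" and R: "R \<ge> 0" "\<And>c. c \<in> eigenvalues A \<Longrightarrow> cmod c \<le> R"
    and n: "n \<noteq> 0"
  shows "principal_eigenvector A (n *\<^sub>R g)"
proof -
  have "cmat A *v cvec g = complex_of_real R *s cvec g"
    by (simp add: cmat_mult_cvec g vec_eq_iff)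
  then have "complex_of_real R \<in> eigenvalues A"
    using g(1) unfolding eigenvalues_def by (metis (mono_tags, lifting) cvec_eq_0_iff mem_Collect_eq)
  then have "R \<in> cmod ` eigenvalues A"
    using R(1) by (metis abs_of_nonneg image_eqI norm_of_real)
  then have "spectral_radius A = R"
    unfolding spectral_radius_def using R(2) by (intro Max_eqI) (auto simp: finite_eigenvalues)
  moreover have "A *v (n *\<^sub>R g) = R *s (n *\<^sub>R g)"
    using g(2) by (simp add: scalar_mult_eq_scaleR vector_scalar_commute matrix_vector_mult_scaleR)
  ultimately show ?thesis
    unfolding principal_eigenvector_def using g(1) n R(1) by auto
qed

section \<open>Author and paper scores\<close>

theorem theorem1:
  fixes M :: "real^'p^'a" and C :: "real^'p^'p"
  assumes M01: "\<forall>i j. M $ i $ j = 0 \<or> M $ i $ j = 1"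
    and C01: "\<forall>j k. C $ j $ k = 0 \<or> C $ j $ k = 1"
    and authored: "\<forall>j. (\<Sum>i\<in>UNIV. M $ i $ j) \<ge> 1"
    and acyc: "acyclic {(j, k). C $ j $ k = 1}"
  defines "P \<equiv> weight_matrix M ** (mat 1 + transpose C) ** transpose M"
    and "Q \<equiv> (mat 1 + transpose C) ** transpose M ** weight_matrix M"
  shows "\<exists>xs ys.
           (\<lambda>k. power_iter P k) \<longlonglongrightarrow> xs \<and>
           (\<lambda>k. power_iter Q k) \<longlonglongrightarrow> ys \<and>
           principal_eigenvector P xs \<and> principal_eigenvector Q ys \<and>
           (\<forall>i. xs $ i \<ge> 0) \<and> (\<Sum>i\<in>UNIV. xs $ i) = 1 \<and>
           (\<forall>j. ys $ j \<ge> 0) \<and> (\<Sum>j\<in>UNIV. ys $ j) = 1"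
proof -
  define W where "W = weight_matrix M"
  define B where "B = (mat 1 + transpose C) ** transpose M"
  have P: "P = W ** B" by (simp add: P_def W_def B_def matrix_mul_assoc)
  have Q: "Q = B ** W" by (simp add: Q_def W_def B_def)
  have M0: "M $ i $ j \<ge> 0" for i j using M01[rule_format, of i j] by auto
  have C0: "C $ i $ j \<ge> 0" for i j using C01[rule_format, of i j] by auto
  have d0: "(\<Sum>l\<in>UNIV. M $ l $ j) > 0" for j using authored[rule_format, of j] by linarith
  have W0: "W $ i $ j \<ge> 0" for i j
    using M0 d0[of j] by (simp add: W_def weight_matrix_def)
  have W1: "(\<Sum>i\<in>UNIV. W $ i $ j) = 1" for j
    using d0[of j] by (simp add: W_def weight_matrix_def flip: sum_divide_distrib)
  \<comment> \<open>The identity in \<open>mat 1 + transpose C\<close> contributes the entry of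
    \<open>M\<close>; the citations only add nonnegative terms.\<close>
  have BM: "M $ i $ j \<le> B $ j $ i" for i j
  proof -
    have "B $ j $ i = M $ i $ j + (\<Sum>k\<in>UNIV. C $ k $ j * M $ i $ k)"
      by (simp add: B_def matrix_matrix_mult_def transpose_def mat_def algebra_simps sum.distrib
          if_distrib[of "\<lambda>x. x * _"] if_distrib[of "\<lambda>x. _ * x"] cong: if_cong)
    moreover have "(\<Sum>k\<in>UNIV. C $ k $ j * M $ i $ k) \<ge> 0"
      by (intro sum_nonneg mult_nonneg_nonneg C0 M0)
    ultimately show ?thesis by simp
  qed
  have B0: "B $ j $ i \<ge> 0" for i j using BM[of i j] M0[of i j] by linarith
  have Q0: "Q $ i $ j \<ge> 0" for i j
    unfolding Q by (auto simp: matrix_matrix_mult_def intro!: sum_nonneg mult_nonneg_nonneg B0 W0)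
  have P0: "P $ i $ j \<ge> 0" for i j
    unfolding P by (auto simp: matrix_matrix_mult_def intro!: sum_nonneg mult_nonneg_nonneg B0 W0)
  \<comment> \<open>As \<open>M\<close> is 0-1, multiplying \<open>W\<close> entrywise by
    \<open>M\<close> changes nothing, so the diagonal of \<open>transpose M ** W\<close> consists of
    the column sums of \<open>W\<close>, all equal to 1.\<close>
  have Q1: "Q $ j $ j \<ge> 1" for j
  proof -
    have "M $ i $ j * W $ i $ j = W $ i $ j" for i
      using M01[rule_format, of i j] by (auto simp: W_def weight_matrix_def)
    then have "1 = (\<Sum>i\<in>UNIV. M $ i $ j * W $ i $ j)" by (simp only: W1)
    also have "\<dots> \<le> (\<Sum>i\<in>UNIV. B $ j $ i * W $ i $ j)"
      by (intro sum_mono mult_right_mono BM W0)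
    finally show ?thesis by (simp add: Q matrix_matrix_mult_def)
  qed

  obtain R g h where Rgh: "R \<ge> 1" "\<And>k. k > 0 \<Longrightarrow> h k > 0"
    "(\<lambda>k. (1 / h k) *\<^sub>R (((*v) Q) ^^ k) (\<chi> i. 1)) \<longlonglongrightarrow> g" "g \<noteq> 0" "Q *v g = R *s g"
    "\<And>c. c \<in> eigenvalues Q \<Longrightarrow> cmod c \<le> R"
    by (rule positive_power_iteration[OF Q0 Q1, of "\<chi> i. 1"]) auto
  define ys where "ys = (1 / norm1 g) *\<^sub>R g"
  have nonneg: "((((*v) Q) ^^ k) (\<chi> i. 1)) $ i \<ge> 0" for k i
    by (rule funpow_mult_vector_nonneg[OF Q0]) simp
  note y = normalized_tendsto[OF nonneg Rgh(2,3,4), folded ys_def]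
  have "norm1 g \<noteq> 0"
    using y(3) by (auto simp: ys_def)
  then have yP: "principal_eigenvector Q ys"
    unfolding ys_def using Rgh by (intro principal_eigenvectorI) auto

  \<comment> \<open>Diagonal entries of \<open>P\<close> can be below 1 (an author without papers
    gives a zero row), so \<open>P\<close> is reached through \<open>Q\<close> started at
    \<open>u\<close>, which is positive because every paper has an author.\<close>
  define u where "u = B *v (\<chi> i. 1)"
  have upos: "u $ j > 0" for j
  proof -
    have "0 < (\<Sum>i\<in>UNIV. M $ i $ j)" by (rule d0)
    also have "\<dots> \<le> (\<Sum>i\<in>UNIV. B $ j $ i)" by (intro sum_mono BM)
    finally show ?thesis by (simp add: u_def matrix_vector_mult_def)
  qed
  obtain R' g' h' where Rgh': "R' \<ge> 1" "\<And>k. k > 0 \<Longrightarrow> h' k > 0"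
    "(\<lambda>k. (1 / h' k) *\<^sub>R (((*v) Q) ^^ k) u) \<longlonglongrightarrow> g'" "g' \<noteq> 0" "Q *v g' = R' *s g'"
    "\<And>c. c \<in> eigenvalues Q \<Longrightarrow> cmod c \<le> R'"
    by (rule positive_power_iteration[OF Q0 Q1 upos]) auto
  \<comment> \<open>Regrouping \<open>(W B) ^ (k+1) = W (B W) ^ k B\<close> costs one step, so
    convergence is first shown for the shifted sequence.\<close>
  have iter: "(((*v) P) ^^ Suc k) (\<chi> i. 1) = W *v (((*v) Q) ^^ k) u" for k
  proof (induction k)
    case 0 show ?case by (simp add: P u_def matrix_vector_mul_assoc)
  next
    case (Suc k)
    have "(((*v) P) ^^ Suc (Suc k)) (\<chi> i. 1) = P *v (W *v (((*v) Q) ^^ k) u)"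
      using arg_cong[OF Suc, of "(*v) P"] by simp
    then show ?case by (simp add: P Q matrix_vector_mul_assoc matrix_mul_assoc)
  qed
  have "(\<lambda>k. W *v ((1 / h' k) *\<^sub>R (((*v) Q) ^^ k) u)) \<longlonglongrightarrow> W *v g'"
    by (rule tendsto_compose[OF _ Rgh'(3)]) (rule isContD[OF linear_continuous_at], simp)
  then have limW: "(\<lambda>k. (1 / h' k) *\<^sub>R (((*v) P) ^^ Suc k) (\<chi> i. 1)) \<longlonglongrightarrow> W *v g'"
    unfolding iter by (simp add: matrix_vector_mult_scaleR)
  have PW: "P *v (W *v g') = R' *s (W *v g')"
    by (metis P Q Rgh'(5) matrix_mul_assoc matrix_vector_mul_assoc vector_scalar_commute)
  \<comment> \<open>This vector is \<open>Q *v g'\<close>, that is \<open>R' *s g'\<close> with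
    \<open>R' \<ge> 1\<close>.\<close>
  have "B *v (W *v g') \<noteq> 0"
    using Rgh' by (simp add: Q matrix_vector_mul_assoc)
  then have Wg: "W *v g' \<noteq> 0" by auto
  \<comment> \<open>For \<open>c \<noteq> 0\<close> the map \<open>B\<close> carries eigenvectors of
    \<open>P\<close> to eigenvectors of \<open>Q\<close>: \<open>W (B z) = c z\<close> keeps
    \<open>B z\<close> from vanishing. For \<open>c = 0\<close> the vector \<open>B z\<close> may
    vanish, but the bound is trivial.\<close>
  have eigP: "cmod c \<le> R'" if c: "c \<in> eigenvalues P" for c
  proof (cases "c = 0")
    case True then show ?thesis using Rgh'(1) by simp
  next
    case False
    obtain z where z: "z \<noteq> 0" "cmat P *v z = c *s z"
      using c by (auto simp: eigenvalues_def)
    define cB :: "complex^'a^'p" where "cB = (\<chi> i j. complex_of_real (B $ i $ j))"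
    define cW :: "complex^'p^'a" where "cW = (\<chi> i j. complex_of_real (W $ i $ j))"
    have cP: "cmat P = cW ** cB" and cQ: "cmat Q = cB ** cW"
      by (simp_all add: P Q cmat_def cB_def cW_def matrix_matrix_mult_def vec_eq_iff)
    have "cW *v (cB *v z) \<noteq> 0"
      using z False by (simp add: cP matrix_vector_mul_assoc)
    then have "cB *v z \<noteq> 0" by auto
    moreover have "cmat Q *v (cB *v z) = c *s (cB *v z)"
      by (metis cP cQ z(2) matrix_mul_assoc matrix_vector_mul_assoc vector_scalar_commute)
    ultimately have "c \<in> eigenvalues Q" unfolding eigenvalues_def by blast
    then show ?thesis by (rule Rgh'(6))
  qed
  define xs where "xs = (1 / norm1 (W *v g')) *\<^sub>R (W *v g')"
  have nonnegP: "((((*v) P) ^^ Suc k) (\<chi> i. 1)) $ i \<ge> 0" for k i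
    by (rule funpow_mult_vector_nonneg[OF P0]) simp
  note x = normalized_tendsto[OF nonnegP Rgh'(2) limW Wg, folded xs_def]
  have "norm1 (W *v g') \<noteq> 0"
    using x(3) by (auto simp: xs_def)
  then have xP: "principal_eigenvector P xs"
    unfolding xs_def using Rgh'(1) PW Wg eigP by (intro principal_eigenvectorI) auto
  have "(\<lambda>k. power_iter P (Suc k)) \<longlonglongrightarrow> xs"
    using x(1) by (simp only: power_iter_def Let_def)
  then have "power_iter P \<longlonglongrightarrow> xs" by (rule LIMSEQ_imp_Suc)
  moreover have "power_iter Q \<longlonglongrightarrow> ys"
    using y(1) by (simp only: power_iter_def[abs_def] Let_def)
  ultimately show ?thesis using xP yP x(2,3) y(2,3) by blast
qed

end
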